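(* Let $p$ be a prime with $p\equiv 3\pmod 4$, let $t\geq 1$ be an integer, $q=p^{2t}$ and $r=\frac{q-1}{4}$. The Smith group of the Peisert graph $P^*(q)$, i.e. the cokernel of its adjacency matrix $A$ viewed as a map $\mathbb{Z}^{\mathbb{F}_q}\to\mathbb{Z}^{\mathbb{F}_q}$, is isomorphic to $\mathbb{Z}/2r\mathbb{Z}\oplus(\mathbb{Z}/r\mathbb{Z})^{2r}$.
   Context: Let $\beta$ be a primitive element of $\mathbb{F}_q$, let $C_0$ be the subgroup of nonzero fourth powers in $\mathbb{F}_q^\times$, $C_1=\beta C_0$ and $S'=C_0\cup C_1$. The Peisert graph $P^*(q)$ has vertex set $\mathbb{F}_q$, two distinct vertices $x,y$ being adjacent iff $x-y\in S'$ (its isomorphism type does not depend on $\beta$). Its adjacency matrix $A$ is taken with respect to any fixed ordering of $\mathbb{F}_q$. *)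

theory Defs
  imports
    "HOL-Analysis.Cartesian_Space"
    "HOL-Algebra.Product_Groups"
    "HOL-Algebra.Elementary_Groups"
    "HOL-Computational_Algebra.Primes"
begin

definition primitive_element :: "'a::{field,finite} \<Rightarrow> bool" where
  "primitive_element \<beta> \<longleftrightarrow> \<beta> \<noteq> 0 \<and> (\<forall>x. x \<noteq> 0 \<longrightarrow> (\<exists>k::nat. x = \<beta> ^ k))"

definition nonzero_fourth_powers :: "'a::field set" where
  "nonzero_fourth_powers = {x ^ 4 | x. x \<noteq> 0}"

definition peisert_set :: "'a::field \<Rightarrow> 'a set" where
  "peisert_set \<beta> = nonzero_fourth_powers \<union> (\<lambda>x. \<beta> * x) ` nonzero_fourth_powers"

text \<open>The Peisert graph has the whole type as its vertex set, so it is given by its adjacency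
  relation. The relation is symmetric when \<open>- 1\<close> is a fourth power, in particular when the order of
  the field is congruent to 1 modulo 8.\<close>

definition peisert_adj :: "'a::field \<Rightarrow> 'a \<Rightarrow> 'a \<Rightarrow> bool" where
  "peisert_adj \<beta> x y \<longleftrightarrow> x \<noteq> y \<and> x - y \<in> peisert_set \<beta>"

text \<open>Rows and columns are indexed by the vertices themselves, so no ordering has to be chosen.\<close>

definition adjacency_matrix :: "('a::finite \<Rightarrow> 'a \<Rightarrow> bool) \<Rightarrow> int ^ 'a ^ 'a" where
  "adjacency_matrix adj = (\<chi> x y. if adj x y then 1 else 0)"

definition int_vec_group :: "(int ^ 'n::finite) monoid" where
  "int_vec_group = \<lparr>carrier = UNIV, monoid.mult = (+), one = 0\<rparr>"

definition cokernel :: "int ^ 'n::finite ^ 'm::finite \<Rightarrow> (int ^ 'm) set monoid" where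
  "cokernel A = int_vec_group Mod range (\<lambda>v. A *v v)"

definition smith_group :: "('a::finite \<Rightarrow> 'a \<Rightarrow> bool) \<Rightarrow> (int ^ 'a) set monoid" where
  "smith_group adj = cokernel (adjacency_matrix adj)"

lemma comm_group_int_vec_group: "comm_group (int_vec_group :: (int ^ 'n::finite) monoid)"
proof (rule comm_groupI)
  fix x :: "int ^ 'n"
  show "\<exists>y\<in>carrier int_vec_group. y \<otimes>\<^bsub>int_vec_group\<^esub> x = \<one>\<^bsub>int_vec_group\<^esub>"
    by (rule bexI[of _ "- x"]) (simp_all add: int_vec_group_def)
qed (simp_all add: int_vec_group_def add_ac)

lemma normal_range_matrix:
  fixes A :: "int ^ 'n::finite ^ 'm::finite"
  shows "range (\<lambda>v. A *v v) \<lhd> int_vec_group"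
proof -
  interpret comm_group "int_vec_group :: (int ^ 'm) monoid"
    by (rule comm_group_int_vec_group)
  have minus: "inv\<^bsub>int_vec_group\<^esub> y = - y" for y :: "int ^ 'm"
    by (rule inv_equality) (simp_all add: int_vec_group_def)
  have "subgroup (range (\<lambda>v. A *v v)) int_vec_group"
  proof (rule subgroupI)
    fix a assume "a \<in> range (\<lambda>v. A *v v)"
    then obtain v where "a = A *v v" by blast
    then have "- a = A *v (- v)"
      by (simp add: vec_eq_iff matrix_vector_mult_def sum_negf)
    then show "inv\<^bsub>int_vec_group\<^esub> a \<in> range (\<lambda>v. A *v v)"
      by (simp add: minus)
  next
    fix a b assume "a \<in> range (\<lambda>v. A *v v)" "b \<in> range (\<lambda>v. A *v v)"
    then obtain v w where "a = A *v v" "b = A *v w" by blast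
    then have "a + b = A *v (v + w)"
      by (simp add: matrix_vector_right_distrib)
    then show "a \<otimes>\<^bsub>int_vec_group\<^esub> b \<in> range (\<lambda>v. A *v v)"
      by (simp add: int_vec_group_def)
  qed (auto simp: int_vec_group_def)
  then show ?thesis by (rule subgroup_imp_normal)
qed

end

theory Submission
  imports Defs "HOL-Number_Theory.Residues"
begin

text \<open>
  Multiplication by \<open>C\<^sub>0\<close> together with \<open>x \<mapsto> \<beta> x\<^sup>p\<close> acts transitively on \<open>S'\<close> and on its complement
  in the units, and multiplication by \<open>\<beta>\<^sup>2\<close> exchanges the two. Hence the Peisert graph is a
  self-complementary strongly regular graph with \<open>A\<^sup>2 = r I - A + r J\<close>.

  On the lattice \<open>Y\<close> of vectors with coordinate sum \<open>0\<close> this reads \<open>A (A + 1) = r\<close>, so modulo \<open>r\<close> the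
  space \<open>Y\<close> splits as \<open>A Y \<oplus> (A + 1) Y\<close>; self-complementarity makes the two summands isomorphic.
  Therefore \<open>Y / A Y\<close> is a \<open>\<int>/r\<close>-module \<open>P\<close> with \<open>P \<oplus> P\<close> free of rank \<open>4 r\<close>. Counting dimensions
  modulo every prime divisor of \<open>r\<close> and gluing by the Chinese remainder theorem, \<open>P\<close> is generated by
  \<open>2 r\<close> elements, and then counting the elements of \<open>P \<oplus> P\<close> shows that they form a basis. The
  coordinate sum finally splits off \<open>\<int>/2r\<close>, generated by a unit vector \<open>e\<close>, because
  \<open>A (2 (A + 1) e - \<one>) = 2 r e\<close> for the all-ones vector \<open>\<one>\<close>.
\<close>

section \<open>The lattice of vectors with coordinate sum zero\<close>

definition sum_zero :: "(int ^ 'n::finite) set" where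
  "sum_zero = {v. (\<Sum>x\<in>UNIV. v $ x) = 0}"

lemma sum_zero_0 [simp]: "0 \<in> sum_zero"
  by (simp add: sum_zero_def)

lemma sum_zero_add [simp]: "v \<in> sum_zero \<Longrightarrow> w \<in> sum_zero \<Longrightarrow> v + w \<in> sum_zero"
  by (simp add: sum_zero_def sum.distrib)

lemma sum_zero_diff [simp]: "v \<in> sum_zero \<Longrightarrow> w \<in> sum_zero \<Longrightarrow> v - w \<in> sum_zero"
  by (simp add: sum_zero_def sum_subtractf)

lemma sum_zero_uminus [simp]: "v \<in> sum_zero \<Longrightarrow> - v \<in> sum_zero"
  by (simp add: sum_zero_def sum_negf)

lemma sum_zero_smult [simp]: "v \<in> sum_zero \<Longrightarrow> c *s v \<in> sum_zero"
  by (simp add: sum_zero_def flip: sum_distrib_left)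

lemma sum_zero_sum [simp]: "(\<And>j. j \<in> J \<Longrightarrow> f j \<in> sum_zero) \<Longrightarrow> sum f J \<in> sum_zero"
  by (induction J rule: infinite_finite_induct) auto

section \<open>Linearity of integer matrices and of combinations of vectors\<close>

lemma matrix_vector_mult_smult:
  fixes A :: "int ^ 'n::finite ^ 'm::finite"
  shows "A *v (c *s v) = c *s (A *v v)"
  by (simp add: vec_eq_iff matrix_vector_mult_def sum_distrib_left mult.left_commute)

lemma matrix_vector_mult_uminus:
  fixes A :: "int ^ 'n::finite ^ 'm::finite"
  shows "A *v (- v) = - (A *v v)"
  by (simp add: vec_eq_iff matrix_vector_mult_def sum_negf)

lemma matrix_vector_mult_sum_right:
  fixes A :: "int ^ 'n::finite ^ 'm::finite"
  shows "A *v (\<Sum>j\<in>J. a j *s f j) = (\<Sum>j\<in>J. a j *s (A *v f j))"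
  by (induction J rule: infinite_finite_induct)
    (auto simp: matrix_vector_right_distrib matrix_vector_mult_smult)

lemmas matrix_linear = matrix_vector_right_distrib matrix_vector_mult_diff_distrib
  matrix_vector_mult_smult matrix_vector_mult_uminus

lemma sum_smult_add:
  fixes f :: "'j \<Rightarrow> int ^ 'n"
  shows "(\<Sum>j\<in>J. (a j + b j) *s f j) = (\<Sum>j\<in>J. a j *s f j) + (\<Sum>j\<in>J. b j *s f j)"
  by (simp add: vector_sadd_rdistrib sum.distrib)

lemma sum_smult_diff:
  fixes f :: "'j \<Rightarrow> int ^ 'n"
  shows "(\<Sum>j\<in>J. (a j - b j) *s f j) = (\<Sum>j\<in>J. a j *s f j) - (\<Sum>j\<in>J. b j *s f j)"
  by (simp add: vector_sub_rdistrib sum_subtractf)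

lemma sum_smult_smult:
  fixes f :: "'j \<Rightarrow> int ^ 'n"
  shows "(\<Sum>j\<in>J. (c * a j) *s f j) = c *s (\<Sum>j\<in>J. a j *s f j)"
  by (induction J rule: infinite_finite_induct) (auto simp: vector_smult_assoc vector_add_ldistrib)

section \<open>Counting in the lattice modulo \<open>m\<close>\<close>

text \<open>The coordinate at \<open>z\<close> is dropped because sum 0 determines it from the
  others. Restriction to an extensional function lets the values be counted in a \<open>PiE\<close>
  set.\<close>

definition coords_mod :: "'n \<Rightarrow> nat \<Rightarrow> int ^ 'n::finite \<Rightarrow> 'n \<Rightarrow> int" where
  "coords_mod z m v = (\<lambda>x\<in>UNIV - {z}. v $ x mod int m)"

lemma coords_mod_eq_iff:
  assumes "v \<in> sum_zero" "w \<in> sum_zero" and "m > 0"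
  shows "coords_mod z m v = coords_mod z m w \<longleftrightarrow> (\<exists>u\<in>sum_zero. v - w = int m *s u)"
proof
  assume "\<exists>u\<in>sum_zero. v - w = int m *s u"
  then obtain u where "v = w + int m *s u"
    by (metis add.commute diff_add_cancel)
  then show "coords_mod z m v = coords_mod z m w"
    by (simp add: coords_mod_def cong: restrict_cong)
next
  assume eq: "coords_mod z m v = coords_mod z m w"
  define d where "d = v - w"
  have d: "d \<in> sum_zero"
    using assms by (simp add: d_def)
  have dvd: "int m dvd d $ x" if "x \<noteq> z" for x
    using fun_cong[OF eq, of x] that by (simp add: coords_mod_def d_def mod_eq_dvd_iff)
  have "(\<Sum>x\<in>UNIV. d $ x) = d $ z + (\<Sum>x\<in>UNIV - {z}. d $ x)"
    by (rule sum.remove) auto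
  then have "d $ z = - (\<Sum>x\<in>UNIV - {z}. d $ x)"
    using d by (simp add: sum_zero_def)
  then have "int m dvd d $ z"
    by (auto intro!: dvd_sum dvd)
  with dvd have dvd': "int m dvd d $ x" for x
    by (cases "x = z") auto
  define u where "u = (\<chi> x. d $ x div int m)"
  have du: "d = int m *s u"
    using dvd' by (simp add: u_def vec_eq_iff)
  then have "int m * (\<Sum>x\<in>UNIV. u $ x) = (\<Sum>x\<in>UNIV. d $ x)"
    by (simp add: sum_distrib_left)
  then have "u \<in> sum_zero"
    using d \<open>m > 0\<close> by (simp add: sum_zero_def)
  with du show "\<exists>u\<in>sum_zero. v - w = int m *s u"
    by (auto simp: d_def)
qed

text \<open>Pigeonhole: by independence the \<open>m ^ card J\<close> reduced coefficient vectors
  inject into the \<open>m ^ (CARD('n) - 1)\<close> residue vectors.\<close>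

lemma card_le_of_independent_mod:
  fixes h :: "'j \<Rightarrow> int ^ 'n::finite"
  assumes "finite J" and m: "m \<ge> 2" and h: "\<And>j. j \<in> J \<Longrightarrow> h j \<in> sum_zero"
    and indep: "\<And>a u j. u \<in> sum_zero \<Longrightarrow> (\<Sum>j\<in>J. a j *s h j) = int m *s u \<Longrightarrow> j \<in> J
      \<Longrightarrow> int m dvd a j"
  shows "card J \<le> CARD('n) - 1"
proof -
  fix z :: 'n
  let ?D = "J \<rightarrow>\<^sub>E {0..<int m}" and ?X = "UNIV - {z}"
  let ?F = "\<lambda>a. coords_mod z m (\<Sum>j\<in>J. a j *s h j)"
  have "inj_on ?F ?D"
  proof (rule inj_onI)
    fix a b assume ab: "a \<in> ?D" "b \<in> ?D" and eq: "?F a = ?F b"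
    have "\<exists>u\<in>sum_zero. (\<Sum>j\<in>J. a j *s h j) - (\<Sum>j\<in>J. b j *s h j) = int m *s u"
      using eq m h by (subst (asm) coords_mod_eq_iff) auto
    then have *: "int m dvd a j - b j" if "j \<in> J" for j
      using indep[of _ "\<lambda>j. a j - b j" j] that by (auto simp: sum_smult_diff)
    show "a = b"
    proof (rule PiE_ext[OF ab])
      fix j assume "j \<in> J"
      then have "a j mod int m = b j mod int m" "a j \<in> {0..<int m}" "b j \<in> {0..<int m}"
        using * ab by (auto simp: mod_eq_dvd_iff)
      then show "a j = b j" by simp
    qed
  qed
  moreover have "?F ` ?D \<subseteq> ?X \<rightarrow>\<^sub>E {0..<int m}"
    using m by (auto simp: coords_mod_def split: if_splits)
  moreover have "finite (?X \<rightarrow>\<^sub>E {0..<int m})"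
    by (auto intro: finite_PiE)
  ultimately have "card ?D \<le> card (?X \<rightarrow>\<^sub>E {0..<int m})"
    by (rule card_inj_on_le)
  then have "m ^ card J \<le> m ^ card ?X"
    using \<open>finite J\<close> by (simp add: card_PiE)
  then show ?thesis
    using m by (simp add: card_Diff_subset)
qed

text \<open>Generation makes the map from reduced coefficients to residue vectors surjective. Both
  sides have \<open>m ^ (CARD('n) - 1)\<close> elements, so it is injective, and a relation has the
  same image as the zero coefficients.\<close>

lemma independent_mod_of_generating:
  fixes h :: "'j \<Rightarrow> int ^ 'n::finite"
  assumes "finite J" and card: "card J = CARD('n) - 1" and m: "m > 0"
    and h: "\<And>j. j \<in> J \<Longrightarrow> h j \<in> sum_zero"
    and gen: "\<And>y. y \<in> sum_zero \<Longrightarrow> \<exists>a. \<exists>u\<in>sum_zero. y = (\<Sum>j\<in>J. a j *s h j) + int m *s u"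
    and "u \<in> sum_zero" "(\<Sum>j\<in>J. a j *s h j) = int m *s u" "j \<in> J"
  shows "int m dvd a j"
proof -
  fix z :: 'n
  let ?D = "J \<rightarrow>\<^sub>E {0..<int m}" and ?X = "UNIV - {z}"
  let ?F = "\<lambda>a. coords_mod z m (\<Sum>j\<in>J. a j *s h j)"
  have F_mod: "?F (\<lambda>j\<in>J. a j mod int m) = ?F a" for a
  proof (subst coords_mod_eq_iff)
    have "(\<Sum>j\<in>J. (\<lambda>j\<in>J. a j mod int m) j *s h j) - (\<Sum>j\<in>J. a j *s h j)
        = (\<Sum>j\<in>J. (int m * - (a j div int m)) *s h j)"
      unfolding sum_smult_diff[symmetric]
      by (rule sum.cong) (auto simp: minus_mult_div_eq_mod[symmetric])
    also have "\<dots> = int m *s (\<Sum>j\<in>J. (- (a j div int m)) *s h j)"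
      by (rule sum_smult_smult)
    finally show "\<exists>u\<in>sum_zero. (\<Sum>j\<in>J. (\<lambda>j\<in>J. a j mod int m) j *s h j) - (\<Sum>j\<in>J. a j *s h j)
        = int m *s u"
      using h by (intro bexI[of _ "\<Sum>j\<in>J. (- (a j div int m)) *s h j"]) auto
  qed (use m h in auto)
  have mod_D: "(\<lambda>j\<in>J. a j mod int m) \<in> ?D" for a
    using m by auto
  have "?F ` ?D = ?X \<rightarrow>\<^sub>E {0..<int m}"
  proof (intro equalityI subsetI)
    fix c assume c: "c \<in> ?X \<rightarrow>\<^sub>E {0..<int m}"
    \<comment> \<open>A lift of \<open>c\<close> to the lattice: the coordinate at \<open>z\<close>
      is forced by sum 0.\<close>
    define y where "y = (\<chi> x. if x = z then - (\<Sum>x\<in>?X. c x) else c x)"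
    have "(\<Sum>x\<in>UNIV. y $ x) = y $ z + (\<Sum>x\<in>?X. y $ x)"
      by (rule sum.remove) auto
    also have "(\<Sum>x\<in>?X. y $ x) = (\<Sum>x\<in>?X. c x)"
      by (rule sum.cong) (auto simp: y_def)
    finally have y: "y \<in> sum_zero"
      by (simp add: sum_zero_def y_def)
    then obtain a u where u: "u \<in> sum_zero" "y = (\<Sum>j\<in>J. a j *s h j) + int m *s u"
      using gen by blast
    have "coords_mod z m y = ?F a"
      using u m h y by (subst coords_mod_eq_iff) auto
    moreover have "coords_mod z m y = c"
      using c by (auto simp: coords_mod_def y_def fun_eq_iff PiE_iff extensional_def)
    ultimately have "c = ?F (\<lambda>j\<in>J. a j mod int m)"
      by (simp only: F_mod)
    then show "c \<in> ?F ` ?D"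
      using mod_D by blast
  qed (use m in \<open>auto simp: coords_mod_def split: if_splits\<close>)
  moreover have "card (?X \<rightarrow>\<^sub>E {0..<int m}) = card ?D"
    using \<open>finite J\<close> card by (simp add: card_PiE card_Diff_subset)
  ultimately have inj: "inj_on ?F ?D"
    using \<open>finite J\<close> by (intro eq_card_imp_inj_on) (auto intro: finite_PiE)
  have "?F a = ?F (\<lambda>j. 0)"
    using assms by (subst coords_mod_eq_iff) auto
  then have "?F (\<lambda>j\<in>J. a j mod int m) = ?F (\<lambda>j\<in>J. 0 mod int m)"
    by (simp only: F_mod)
  then have "(\<lambda>j\<in>J. a j mod int m) = (\<lambda>j\<in>J. 0 mod int m)"
    by (rule inj_onD[OF inj _ mod_D mod_D])
  from fun_cong[OF this, of j] show ?thesis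
    using \<open>j \<in> J\<close> by (simp add: dvd_eq_mod_eq_0)
qed

section \<open>Quotients of conference type\<close>

text \<open>For \<open>Y = sum_zero\<close> preserved by \<open>A\<close> and
  \<open>P = Y / A Y\<close>, this says that the classes of \<open>g\<close> generate
  \<open>P / m P\<close>.\<close>

definition generates_mod ::
  "int ^ 'n::finite ^ 'n \<Rightarrow> 'j set \<Rightarrow> ('j \<Rightarrow> int ^ 'n) \<Rightarrow> int \<Rightarrow> bool" where
  "generates_mod A J g m \<longleftrightarrow> (\<forall>y\<in>sum_zero. \<exists>a. \<exists>u\<in>sum_zero. \<exists>w\<in>sum_zero.
     y = (\<Sum>j\<in>J. a j *s g j) + A *v u + m *s w)"

lemma generates_modE:
  assumes "generates_mod A J g m" "y \<in> sum_zero"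
  obtains a u w where "u \<in> sum_zero" "w \<in> sum_zero"
    "y = (\<Sum>j\<in>J. a j *s g j) + A *v u + m *s w"
  using assms unfolding generates_mod_def by blast

lemma generates_mod_dvd:
  assumes "generates_mod A J g m" and "l dvd m"
  shows "generates_mod A J g l"
  unfolding generates_mod_def
proof
  fix y :: "int ^ 'a" assume "y \<in> sum_zero"
  with assms(1) obtain a u w where uw: "u \<in> sum_zero" "w \<in> sum_zero"
    "y = (\<Sum>j\<in>J. a j *s g j) + A *v u + m *s w"
    by (rule generates_modE)
  moreover obtain k where "m = l * k"
    using \<open>l dvd m\<close> by blast
  ultimately have "y = (\<Sum>j\<in>J. a j *s g j) + A *v u + l *s (k *s w)"
    by (simp add: vector_smult_assoc)
  with uw show "\<exists>a. \<exists>u\<in>sum_zero. \<exists>w\<in>sum_zero. y = (\<Sum>j\<in>J. a j *s g j) + A *v u + l *s w"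
    using sum_zero_smult by blast
qed

text \<open>Expanding the remainder \<open>w\<close> left modulo \<open>k\<close> once more modulo
  \<open>l\<close> turns the error into a multiple of \<open>k * l\<close>.\<close>

lemma generates_mod_mult:
  assumes "generates_mod A J g k" and "generates_mod A J g l"
  shows "generates_mod A J g (k * l)"
  unfolding generates_mod_def
proof
  fix y :: "int ^ 'a" assume "y \<in> sum_zero"
  with assms(1) obtain a u w where 1: "u \<in> sum_zero" "w \<in> sum_zero"
    "y = (\<Sum>j\<in>J. a j *s g j) + A *v u + k *s w"
    by (rule generates_modE)
  obtain a' u' w' where 2: "u' \<in> sum_zero" "w' \<in> sum_zero"
    "w = (\<Sum>j\<in>J. a' j *s g j) + A *v u' + l *s w'"
    using assms(2) 1(2) by (rule generates_modE)
  have "y = (\<Sum>j\<in>J. (a j + k * a' j) *s g j) + A *v (u + k *s u') + (k * l) *s w'"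
    using 1(3) by (simp add: 2(3) sum_smult_add sum_smult_smult matrix_linear vector_add_ldistrib
        vector_smult_assoc add_ac)
  with 1 2 show "\<exists>a. \<exists>u\<in>sum_zero. \<exists>w\<in>sum_zero.
      y = (\<Sum>j\<in>J. a j *s g j) + A *v u + (k * l) *s w"
    by (intro exI[of _ "\<lambda>j. a j + k * a' j"] bexI[of _ "u + k *s u'"] bexI[of _ w']) auto
qed

lemma generates_mod_cong:
  assumes "generates_mod A J g m"
    and "\<And>j. j \<in> J \<Longrightarrow> \<exists>w\<in>sum_zero. g j = g' j + m *s w"
  shows "generates_mod A J g' m"
  unfolding generates_mod_def
proof
  fix y :: "int ^ 'a" assume "y \<in> sum_zero"
  with assms(1) obtain a u w where uw: "u \<in> sum_zero" "w \<in> sum_zero"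
    "y = (\<Sum>j\<in>J. a j *s g j) + A *v u + m *s w"
    by (rule generates_modE)
  obtain d where d: "\<And>j. j \<in> J \<Longrightarrow> d j \<in> sum_zero \<and> g j = g' j + m *s d j"
    using assms(2) by metis
  have "(\<Sum>j\<in>J. a j *s g j) = (\<Sum>j\<in>J. a j *s g' j + (m * a j) *s d j)"
    using d by (intro sum.cong) (auto simp: vector_add_ldistrib vector_smult_assoc mult.commute)
  also have "\<dots> = (\<Sum>j\<in>J. a j *s g' j) + m *s (\<Sum>j\<in>J. a j *s d j)"
    by (simp add: sum.distrib sum_smult_smult)
  finally have "y = (\<Sum>j\<in>J. a j *s g' j) + A *v u + m *s (w + (\<Sum>j\<in>J. a j *s d j))"
    using uw(3) by (simp add: vector_add_ldistrib)
  moreover have "w + (\<Sum>j\<in>J. a j *s d j) \<in> sum_zero"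
    using uw d by auto
  ultimately show "\<exists>a. \<exists>u\<in>sum_zero. \<exists>w\<in>sum_zero.
      y = (\<Sum>j\<in>J. a j *s g' j) + A *v u + m *s w"
    using uw by blast
qed

text \<open>A generator whose coefficient in some relation is invertible modulo \<open>m\<close> is superfluous.\<close>

lemma generates_mod_remove:
  assumes "generates_mod A J g m" and J: "finite J" "k \<in> J" and "coprime (a k) m"
    and u: "u \<in> sum_zero" and w: "w \<in> sum_zero"
    and rel: "(\<Sum>j\<in>J. a j *s g j) = A *v u + m *s w" and g: "\<And>j. j \<in> J \<Longrightarrow> g j \<in> sum_zero"
  shows "generates_mod A (J - {k}) g m"
  unfolding generates_mod_def
proof
  fix y :: "int ^ 'a" assume "y \<in> sum_zero"
  with assms(1) obtain c u' w' where 1: "u' \<in> sum_zero" "w' \<in> sum_zero"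
    "y = (\<Sum>j\<in>J. c j *s g j) + A *v u' + m *s w'"
    by (rule generates_modE)
  obtain s t where st: "s * a k + t * m = 1"
    using bezout_int[of "a k" m] \<open>coprime (a k) m\<close> by auto
  \<comment> \<open>As \<open>s\<close> inverts \<open>a k\<close> modulo \<open>m\<close>,
    subtracting \<open>e\<close> times the relation leaves at \<open>k\<close> only a multiple of
    \<open>m\<close>, which joins the error term.\<close>
  define e where "e = c k * s"
  have ek: "c k = e * a k + m * (c k * t)"
  proof -
    have "c k = c k * (s * a k + t * m)"
      by (simp add: st)
    then show ?thesis
      by (simp add: e_def algebra_simps)
  qed
  have "(\<Sum>j\<in>J. c j *s g j) = (\<Sum>j\<in>J. (c j - e * a j) *s g j) + e *s (\<Sum>j\<in>J. a j *s g j)"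
    by (simp add: sum_smult_diff sum_smult_smult)
  also have "(\<Sum>j\<in>J. (c j - e * a j) *s g j)
      = (c k - e * a k) *s g k + (\<Sum>j\<in>J - {k}. (c j - e * a j) *s g j)"
    using J by (rule sum.remove)
  also have "c k - e * a k = m * (c k * t)"
    using ek by simp
  finally have "y = (\<Sum>j\<in>J - {k}. (c j - e * a j) *s g j) + A *v (u' + e *s u)
      + m *s (w' + e *s w + (c k * t) *s g k)"
    using 1(3) rel by (simp add: matrix_linear vector_add_ldistrib vector_smult_assoc algebra_simps)
  then show "\<exists>a. \<exists>u\<in>sum_zero. \<exists>w\<in>sum_zero.
      y = (\<Sum>j\<in>J - {k}. a j *s g j) + A *v u + m *s w"
    using 1 u w g[OF J(2)]
    by (intro exI[of _ "\<lambda>j. c j - e * a j"] bexI[of _ "u' + e *s u"]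
        bexI[of _ "w' + e *s w + (c k * t) *s g k"]) auto
qed

text \<open>The coefficients are the coordinates of \<open>y\<close>; the contributions of
  \<open>axis z 1\<close> cancel because these sum to 0.\<close>

lemma generates_mod_differences:
  fixes A :: "int ^ 'n::finite ^ 'n"
  shows "generates_mod A (UNIV :: 'n set) (\<lambda>x. axis x 1 - axis z 1) m"
  unfolding generates_mod_def
proof
  fix y :: "int ^ 'n" assume y: "y \<in> sum_zero"
  have "y = (\<Sum>x\<in>UNIV. y $ x *s (axis x 1 - axis z 1))"
  proof -
    have "(\<Sum>x\<in>UNIV. y $ x * axis z 1 $ i) = 0" for i
      using y by (simp add: sum_zero_def flip: sum_distrib_right)
    moreover have "(\<Sum>x\<in>UNIV. y $ x * axis x 1 $ i) = y $ i" for i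
      by (simp add: axis_def if_distrib cong: if_cong)
    ultimately show ?thesis
      by (simp add: vec_eq_iff right_diff_distrib sum_subtractf)
  qed
  then have "y = (\<Sum>x\<in>UNIV. y $ x *s (axis x 1 - axis z 1)) + A *v 0 + m *s 0"
    by simp
  then show "\<exists>a. \<exists>u\<in>sum_zero. \<exists>w\<in>sum_zero.
      y = (\<Sum>x\<in>UNIV. a x *s (axis x 1 - axis z 1)) + A *v u + m *s w"
    by (intro exI[of _ "\<lambda>x. y $ x"] bexI[of _ 0]) auto
qed

lemma axis_diff_sum_zero: "axis x 1 - axis z 1 \<in> sum_zero"
  by (simp add: sum_zero_def sum_subtractf axis_def)

section \<open>The doubling argument and a basis of the quotient\<close>

text \<open>The lattice has rank \<open>2 * N\<close>, on it \<open>A (A + 1) = r\<close>, and the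
  automorphism \<open>Q\<close> conjugates \<open>A\<close> to \<open>- 1 - A\<close>, which
  exchanges \<open>- A\<close> and \<open>A + 1\<close>.\<close>

locale split_lattice =
  fixes A Q :: "int ^ 'n::finite ^ 'n" and r N :: nat
  assumes card: "CARD('n) = 2 * N + 1" and r_pos: "r > 0"
    and A_sum_zero [simp]: "y \<in> sum_zero \<Longrightarrow> A *v y \<in> sum_zero"
    and A_quadratic: "y \<in> sum_zero \<Longrightarrow> A *v (A *v y) = int r *s y - A *v y"
    and Q_bij: "bij_betw ((*v) Q) sum_zero sum_zero"
    and Q_A: "y \<in> sum_zero \<Longrightarrow> Q *v (A *v y) = - (Q *v y) - A *v (Q *v y)"
begin

lemma Q_sum_zero [simp]: "y \<in> sum_zero \<Longrightarrow> Q *v y \<in> sum_zero"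
  using Q_bij by (auto simp: bij_betw_def)

lemma Q_onto:
  assumes "y \<in> sum_zero" obtains z where "z \<in> sum_zero" "y = Q *v z"
  using Q_bij assms by (metis bij_betw_imp_surj_on imageE)

text \<open>Modulo \<open>r\<close>, both \<open>- A\<close> and \<open>A + 1\<close> are idempotents with sum \<open>1\<close>, and \<open>Q\<close> interchanges
  their images, so that generators of one image yield generators of the other.\<close>

lemma generates_doubled:
  assumes gen: "generates_mod A J g m" and "m dvd int r" and y: "y \<in> sum_zero"
  shows "\<exists>a b. \<exists>w\<in>sum_zero. y = (\<Sum>j\<in>J. a j *s (A *v g j + g j))
    + (\<Sum>j\<in>J. b j *s (A *v (Q *v g j))) + m *s w"
proof -
  obtain k where k: "int r = m * k"
    using \<open>m dvd int r\<close> by blast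
  obtain a u w where 1: "u \<in> sum_zero" "w \<in> sum_zero"
    "y = (\<Sum>j\<in>J. a j *s g j) + A *v u + m *s w"
    using gen y by (rule generates_modE)
  \<comment> \<open>Since \<open>A Q A = - r Q\<close> on the lattice, expanding \<open>z\<close>
    modulo the image of \<open>A\<close> expands \<open>A *v y = A *v (Q *v z)\<close> in the
    vectors \<open>A *v (Q *v g j)\<close>.\<close>
  obtain z where z: "z \<in> sum_zero" "y = Q *v z"
    using y by (rule Q_onto)
  obtain b u' w' where 2: "u' \<in> sum_zero" "w' \<in> sum_zero"
    "z = (\<Sum>j\<in>J. b j *s g j) + A *v u' + m *s w'"
    using gen z(1) by (rule generates_modE)
  define s t where "s = (\<Sum>j\<in>J. a j *s g j)" and "t = (\<Sum>j\<in>J. b j *s g j)"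
  have a: "(\<Sum>j\<in>J. a j *s (A *v g j + g j)) = A *v s + s"
    by (simp add: s_def matrix_vector_mult_sum_right vector_add_ldistrib sum.distrib)
  have b: "(\<Sum>j\<in>J. b j *s (A *v (Q *v g j))) = A *v (Q *v t)"
    by (simp add: t_def matrix_vector_mult_sum_right)
  have "A *v y + y = A *v s + s + m *s (k *s u + A *v w + w)"
    using 1 A_quadratic[OF 1(1)]
    by (simp add: s_def[symmetric] matrix_linear vector_add_ldistrib vector_smult_assoc k algebra_simps)
  moreover have "A *v y = A *v (Q *v t) + m *s (A *v (Q *v w') - k *s (Q *v u'))"
    using 2 A_quadratic[of "Q *v u'"]
    by (simp add: z(2) Q_A t_def[symmetric] matrix_linear vector_add_ldistrib vector_ssub_ldistrib
        vector_smult_assoc k algebra_simps)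
  ultimately have "y = (A *v s + s) + A *v (Q *v (- t))
      + m *s (k *s u + A *v w + w - (A *v (Q *v w') - k *s (Q *v u')))"
    by (simp add: matrix_linear vector_add_ldistrib vector_ssub_ldistrib algebra_simps)
  moreover have "A *v (Q *v (- t)) = (\<Sum>j\<in>J. (- b j) *s (A *v (Q *v g j)))"
    by (simp add: matrix_linear b[symmetric] vector_smult_lneg sum_negf)
  ultimately show ?thesis
    unfolding a[symmetric] using 1 2
    by (intro exI[of _ a] exI[of _ "\<lambda>j. - b j"]
        bexI[of _ "k *s u + A *v w + w - (A *v (Q *v w') - k *s (Q *v u'))"]) auto
qed

text \<open>Since \<open>(A + 1) A = r\<close> and \<open>(A + 1)\<^sup>2 = A + 1 + r\<close>,
  applying \<open>A + 1\<close> kills the second summand modulo \<open>m\<close> and keeps the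
  first. So \<open>(A + 1) s\<close> vanishes modulo \<open>m\<close>, that is, \<open>s\<close> is
  congruent to \<open>- A s\<close>. What remains is \<open>A Q t = - Q (A + 1) t\<close>, and
  cancelling \<open>Q\<close> settles \<open>t\<close> likewise.\<close>

lemma relation_doubled:
  assumes "m dvd int r" and st: "s \<in> sum_zero" "t \<in> sum_zero" and w: "w \<in> sum_zero"
    and rel: "(A *v s + s) + A *v (Q *v t) = m *s w"
  shows "\<exists>u\<in>sum_zero. \<exists>w\<in>sum_zero. s = A *v u + m *s w"
    and "\<exists>u\<in>sum_zero. \<exists>w\<in>sum_zero. t = A *v u + m *s w"
proof -
  obtain k where k: "int r = m * k"
    using \<open>m dvd int r\<close> by blast
  have "A *v ((A *v s + s) + A *v (Q *v t)) + ((A *v s + s) + A *v (Q *v t))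
      = m *s (A *v w + w)"
    by (simp add: rel matrix_linear vector_add_ldistrib)
  moreover have "A *v ((A *v s + s) + A *v (Q *v t)) + ((A *v s + s) + A *v (Q *v t))
      = (A *v s + s) + m *s (k *s s + k *s (Q *v t))"
    using st by (simp add: matrix_linear A_quadratic k vector_add_ldistrib vector_smult_assoc)
  ultimately have "m *s (A *v w + w) = (A *v s + s) + m *s (k *s s + k *s (Q *v t))"
    by (rule trans[OF sym])
  moreover define v where "v = A *v w + w - (k *s s + k *s (Q *v t))"
  ultimately have s: "A *v s + s = m *s v"
    by (simp add: vector_ssub_ldistrib)
  have v: "v \<in> sum_zero"
    using w st by (simp add: v_def)
  have "s = A *v (- s) + m *s v"
    by (simp add: matrix_linear flip: s)
  then show "\<exists>u\<in>sum_zero. \<exists>w\<in>sum_zero. s = A *v u + m *s w"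
    using v st sum_zero_uminus by blast
  obtain x where x: "x \<in> sum_zero" "w - v = Q *v x"
    using w v by (auto intro: Q_onto[of "w - v"])
  have "A *v (Q *v t) = m *s (Q *v x)"
    using rel[unfolded s] by (simp add: vector_ssub_ldistrib algebra_simps flip: x(2))
  then have "Q *v (A *v t + t) = Q *v (m *s (- x))"
    using st by (simp add: matrix_linear Q_A vector_smult_rneg)
  then have "A *v t + t = m *s (- x)"
    using Q_bij st x by (auto simp: bij_betw_def dest!: inj_onD)
  then have "t = A *v (- t) + m *s (- x)"
    by (simp add: matrix_linear algebra_simps)
  then show "\<exists>u\<in>sum_zero. \<exists>w\<in>sum_zero. t = A *v u + m *s w"
    using x st sum_zero_uminus by blast
qed

text \<open>A generating set of differences of least size is independent in the quotient, since a
  coefficient not divisible by the prime \<open>l\<close> is invertible. Doubling it gives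
  \<open>2 * card J\<close> vectors independent modulo \<open>l\<close> in rank
  \<open>2 * N\<close>, so \<open>card J \<le> N\<close>.\<close>

lemma exists_generators_prime:
  assumes l: "prime l" "l dvd r"
  shows "\<exists>g :: nat \<Rightarrow> int ^ 'n. (\<forall>i. g i \<in> sum_zero) \<and> generates_mod A {..<N} g (int l)"
proof -
  fix z :: 'n
  define d :: "'n \<Rightarrow> int ^ 'n" where "d = (\<lambda>x. axis x 1 - axis z 1)"
  have d [simp]: "d x \<in> sum_zero" for x
    by (simp add: d_def axis_diff_sum_zero)
  have "generates_mod A UNIV d (int l)"
    unfolding d_def by (rule generates_mod_differences)
  then obtain J where gen: "generates_mod A J d (int l)"
    and min: "\<And>J'. generates_mod A J' d (int l) \<Longrightarrow> card J \<le> card J'"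
    using ex_has_least_nat[of "\<lambda>J. generates_mod A J d (int l)" UNIV card] by blast
  have indep: "int l dvd a k"
    if "k \<in> J" and "\<exists>u\<in>sum_zero. \<exists>w\<in>sum_zero. (\<Sum>j\<in>J. a j *s d j) = A *v u + int l *s w"
    for a k
  proof (rule ccontr)
    assume "\<not> int l dvd a k"
    then have "coprime (a k) (int l)"
      using l by (simp add: prime_imp_coprime coprime_commute)
    with that have "generates_mod A (J - {k}) d (int l)"
      using gen by (auto intro: generates_mod_remove)
    then have "card J \<le> card (J - {k})"
      by (rule min)
    with \<open>k \<in> J\<close> show False
      using card_Diff1_less[of J k] by simp
  qed
  let ?h = "case_sum (\<lambda>j. A *v d j + d j) (\<lambda>j. A *v (Q *v d j))"
  have sum: "(\<Sum>j\<in>J <+> J. a j *s ?h j)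
    = (A *v (\<Sum>j\<in>J. a (Inl j) *s d j) + (\<Sum>j\<in>J. a (Inl j) *s d j))
      + A *v (Q *v (\<Sum>j\<in>J. a (Inr j) *s d j))" for a
    by (simp add: sum.Plus matrix_vector_mult_sum_right vector_add_ldistrib sum.distrib)
  have "card (J <+> J) \<le> CARD('n) - 1"
  proof (rule card_le_of_independent_mod)
    show "2 \<le> l"
      using l(1) by (rule prime_ge_2_nat)
    show "?h j \<in> sum_zero" for j
      by (cases j) auto
    fix a u j assume u: "u \<in> sum_zero" "(\<Sum>j\<in>J <+> J. a j *s ?h j) = int l *s u" and j: "j \<in> J <+> J"
    have S: "(\<Sum>j\<in>J. a (Inl j) *s d j) \<in> sum_zero" "(\<Sum>j\<in>J. a (Inr j) *s d j) \<in> sum_zero"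
      by auto
    have "int l dvd int r"
      using l by simp
    note * = relation_doubled[OF this S u(1) u(2)[unfolded sum]]
    show "int l dvd a j"
      using j indep[OF _ *(1)] indep[OF _ *(2)] by auto
  qed auto
  then have "card J \<le> N"
    by (simp add: card_Plus card)
  obtain e where e: "bij_betw e {..<card J} J"
    using ex_bij_betw_nat_finite[of J] by (auto simp: atLeast0LessThan)
  \<comment> \<open>Padding by 0 gives index set \<open>{..<N}\<close> for every prime, so that
    families can be combined index by index.\<close>
  define g where "g i = (if i < card J then d (e i) else 0)" for i
  have "generates_mod A {..<N} g (int l)"
    unfolding generates_mod_def
  proof
    fix y :: "int ^ 'n" assume "y \<in> sum_zero"
    with gen obtain a u w where 1: "u \<in> sum_zero" "w \<in> sum_zero"
      "y = (\<Sum>j\<in>J. a j *s d j) + A *v u + int l *s w"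
      by (rule generates_modE)
    have "(\<Sum>j\<in>J. a j *s d j) = (\<Sum>i<card J. a (e i) *s d (e i))"
      using sum.reindex_bij_betw[OF e, of "\<lambda>j. a j *s d j"] by simp
    also have "\<dots> = (\<Sum>i<card J. a (e i) *s g i)"
      by (simp add: g_def)
    also have "\<dots> = (\<Sum>i<N. a (e i) *s g i)"
      using \<open>card J \<le> N\<close> by (intro sum.mono_neutral_left) (auto simp: g_def)
    finally show "\<exists>a. \<exists>u\<in>sum_zero. \<exists>w\<in>sum_zero.
        y = (\<Sum>i<N. a i *s g i) + A *v u + int l *s w"
      using 1 by (intro exI[of _ "\<lambda>i. a (e i)"] bexI[of _ u] bexI[of _ w]) auto
  qed
  moreover have "\<forall>i. g i \<in> sum_zero"
    by (simp add: g_def)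
  ultimately show ?thesis
    by blast
qed

text \<open>Induction over prime factors: for a repeated prime, generators modulo \<open>m\<close>
  also generate modulo \<open>l\<close>, hence modulo \<open>l * m\<close>; a new prime is glued in
  by the Chinese remainder theorem.\<close>

lemma exists_generators_dvd:
  assumes "m dvd r"
  shows "\<exists>g :: nat \<Rightarrow> int ^ 'n. (\<forall>i. g i \<in> sum_zero) \<and> generates_mod A {..<N} g (int m)"
  using assms
proof (induction m rule: prime_divisors_induct)
  case zero
  then show ?case
    using r_pos by simp
next
  case (unit m)
  have "generates_mod A {..<N} (\<lambda>_. 0) 1"
    unfolding generates_mod_def
  proof
    fix y :: "int ^ 'n" assume "y \<in> sum_zero"
    then show "\<exists>a. \<exists>u\<in>sum_zero. \<exists>w\<in>sum_zero. y = (\<Sum>i<N. a i *s 0) + A *v u + 1 *s w"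
      by (intro exI[of _ undefined] bexI[of _ 0] bexI[of _ y]) auto
  qed
  with unit show ?case
    by (intro exI[of _ "\<lambda>_. 0"]) auto
next
  case (factor l m)
  then have "m dvd r" "l dvd r"
    by (auto elim: dvd_mult_left dvd_mult_right)
  obtain g where g: "\<And>i. g i \<in> sum_zero" "generates_mod A {..<N} g (int m)"
    using factor.IH \<open>m dvd r\<close> by blast
  show ?case
  proof (cases "l dvd m")
    case True
    then have "generates_mod A {..<N} g (int l)"
      by (intro generates_mod_dvd[OF g(2)]) simp
    from generates_mod_mult[OF this g(2)] g(1) show ?thesis
      by auto
  next
    case False
    obtain h where h: "\<And>i. h i \<in> sum_zero" "generates_mod A {..<N} h (int l)"
      using exists_generators_prime \<open>prime l\<close> \<open>l dvd r\<close> by blast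
    have "coprime (int l) (int m)"
      using False \<open>prime l\<close> by (simp add: prime_imp_coprime)
    then obtain s t where st: "s * int l + t * int m = 1"
      using bezout_int[of "int l" "int m"] by auto
    \<comment> \<open>As \<open>t * m\<close> is 1 modulo \<open>l\<close> and \<open>s * l\<close>
      is 1 modulo \<open>m\<close>, \<open>f i\<close> agrees with \<open>h i\<close> modulo
      \<open>l\<close> and with \<open>g i\<close> modulo \<open>m\<close>.\<close>
    define f where "f i = (t * int m) *s h i + (s * int l) *s g i" for i
    have f: "f i \<in> sum_zero" for i
      using g h by (simp add: f_def)
    have "h i = f i + int l *s (s *s (h i - g i))" for i
    proof -
      have "h i = (s * int l + t * int m) *s h i"
        by (simp add: st)
      then show ?thesis
        by (simp add: f_def vec_eq_iff algebra_simps)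
    qed
    then have "generates_mod A {..<N} f (int l)"
      using g h by (intro generates_mod_cong[OF h(2)]) (blast intro: sum_zero_diff sum_zero_smult)
    moreover have "g i = f i + int m *s (t *s (g i - h i))" for i
    proof -
      have "g i = (s * int l + t * int m) *s g i"
        by (simp add: st)
      then show ?thesis
        by (simp add: f_def vec_eq_iff algebra_simps)
    qed
    then have "generates_mod A {..<N} f (int m)"
      using g h by (intro generates_mod_cong[OF g(2)]) (blast intro: sum_zero_diff sum_zero_smult)
    ultimately have "generates_mod A {..<N} f (int l * int m)"
      by (rule generates_mod_mult)
    with f show ?thesis
      by auto
  qed
qed

text \<open>Generators modulo \<open>r\<close> generate modulo \<open>A\<close> alone, since
  \<open>r = A (A + 1)\<close> absorbs the error. Doubling gives \<open>2 * N\<close> generators of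
  the lattice modulo \<open>r\<close>, as many as its rank, so they are independent modulo
  \<open>r\<close>.\<close>

lemma exists_basis_mod_image:
  obtains g :: "nat \<Rightarrow> int ^ 'n" where "\<And>i. g i \<in> sum_zero"
    and "\<And>y. y \<in> sum_zero \<Longrightarrow> \<exists>a. \<exists>u\<in>sum_zero. y = (\<Sum>i<N. a i *s g i) + A *v u"
    and "\<And>a u i. u \<in> sum_zero \<Longrightarrow> (\<Sum>i<N. a i *s g i) = A *v u \<Longrightarrow> i < N \<Longrightarrow> int r dvd a i"
proof -
  obtain g :: "nat \<Rightarrow> int ^ 'n" where g: "\<And>i. g i \<in> sum_zero"
    and gen: "generates_mod A {..<N} g (int r)"
    using exists_generators_dvd[of r] by auto
  show ?thesis
  proof
    show "g i \<in> sum_zero" for i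
      by (rule g)
  next
    fix y :: "int ^ 'n" assume "y \<in> sum_zero"
    with gen obtain a u w where 1: "u \<in> sum_zero" "w \<in> sum_zero"
      "y = (\<Sum>i<N. a i *s g i) + A *v u + int r *s w"
      by (rule generates_modE)
    have "int r *s w = A *v (A *v w + w)"
      using 1 by (simp add: matrix_linear A_quadratic)
    with 1(3) have "y = (\<Sum>i<N. a i *s g i) + A *v (u + (A *v w + w))"
      by (simp add: matrix_linear)
    moreover have "u + (A *v w + w) \<in> sum_zero"
      using 1 by simp
    ultimately show "\<exists>a. \<exists>u\<in>sum_zero. y = (\<Sum>i<N. a i *s g i) + A *v u"
      by blast
  next
    fix a u i assume u: "u \<in> sum_zero" "(\<Sum>i<N. a i *s g i) = A *v u" and i: "i < N"
    let ?J = "{..<N} <+> {..<N}"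
    let ?h = "case_sum (\<lambda>j. A *v g j + g j) (\<lambda>j. A *v (Q *v g j))"
    have "int r dvd case_sum a (\<lambda>_. 0) (Inl i :: nat + nat)"
    proof (rule independent_mod_of_generating[where J = ?J and h = ?h and a = "case_sum a (\<lambda>_. 0)"
          and u = u])
      show "card ?J = CARD('n) - 1"
        by (simp add: card_Plus card)
      show "0 < r" by (rule r_pos)
      show "?h j \<in> sum_zero" for j
        using g by (cases j) auto
      show "u \<in> sum_zero" by fact
      \<comment> \<open>\<open>A + 1\<close> sends the given relation to one among the doubled
        vectors, with zero coefficients on the second copy; its value is
        \<open>(A + 1) A u = r u\<close>.\<close>
      have "(\<Sum>j\<in>?J. case_sum a (\<lambda>_. 0) j *s ?h j)
          = A *v (\<Sum>i<N. a i *s g i) + (\<Sum>i<N. a i *s g i)"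
        by (simp add: sum.Plus matrix_vector_mult_sum_right vector_add_ldistrib sum.distrib)
      then show "(\<Sum>j\<in>?J. case_sum a (\<lambda>_. 0) j *s ?h j) = int r *s u"
        using u by (simp add: A_quadratic)
      fix y :: "int ^ 'n" assume "y \<in> sum_zero"
      then obtain b c w where w: "w \<in> sum_zero" "y = (\<Sum>j<N. b j *s (A *v g j + g j))
          + (\<Sum>j<N. c j *s (A *v (Q *v g j))) + int r *s w"
        using generates_doubled[OF gen dvd_refl] by blast
      then have "y = (\<Sum>j\<in>?J. case_sum b c j *s ?h j) + int r *s w"
        by (simp add: sum.Plus)
      with w show "\<exists>a. \<exists>u\<in>sum_zero. y = (\<Sum>j\<in>?J. a j *s ?h j) + int r *s u"
        by blast
    qed (use i in auto)
    then show "int r dvd a i"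
      by simp
  qed
qed

end

section \<open>Strong regularity of the Peisert graph\<close>

lemma odd_even_power_mod_8:
  fixes n :: nat
  assumes "odd n"
  shows "n ^ (2 * t) mod 8 = 1"
proof -
  have "odd (n ^ t)"
    using assms by simp
  then obtain k where k: "n ^ t = 2 * k + 1"
    by (rule oddE)
  have "even (k * (k + 1))"
    by simp
  then obtain l where "k * (k + 1) = 2 * l"
    by (rule evenE)
  then have "(n ^ t)\<^sup>2 = 8 * l + 1"
    by (simp add: k power2_eq_square algebra_simps)
  then have "n ^ (2 * t) = 8 * l + 1"
    by (simp add: mult.commute flip: power_mult)
  then show ?thesis
    by simp
qed

lemma CHAR_eq_of_CARD_prime_power:
  assumes "prime p" and "CARD('a::{field,finite}) = p ^ n"
  shows "CHAR('a) = p"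
proof -
  have "prime CHAR('a)"
    by (intro prime_CHAR_semidom finite_imp_CHAR_pos) simp
  moreover have "CHAR('a) dvd p ^ n"
    using CHAR_dvd_CARD[where 'a = 'a] assms(2) by simp
  ultimately show ?thesis
    using \<open>prime p\<close> by (metis prime_dvd_power primes_dvd_imp_eq)
qed

text \<open>The powers below the least positive \<open>n\<close> with \<open>\<beta> ^ n = 1\<close>
  are distinct and exhaust the units, so \<open>n\<close> is the number of units.\<close>

lemma primitive_power_eq_iff:
  fixes \<beta> :: "'a::{field,finite}"
  assumes "primitive_element \<beta>"
  shows "\<beta> ^ k = \<beta> ^ l \<longleftrightarrow> k mod (CARD('a) - 1) = l mod (CARD('a) - 1)"
proof -
  have nz: "\<beta> \<noteq> 0" and gen: "\<And>x. x \<noteq> 0 \<Longrightarrow> \<exists>k. x = \<beta> ^ k"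
    using assms by (auto simp: primitive_element_def)
  have "\<not> inj (\<lambda>k::nat. \<beta> ^ k)"
    using finite_imageD[of "\<lambda>k::nat. \<beta> ^ k" UNIV] by auto
  then obtain i j :: nat where "i < j" "\<beta> ^ i = \<beta> ^ j"
    by (metis injI linorder_neqE_nat)
  have "\<beta> ^ i * \<beta> ^ (j - i) = \<beta> ^ (i + (j - i))"
    by (rule power_add[symmetric])
  also have "\<dots> = \<beta> ^ i * 1"
    using \<open>i < j\<close> \<open>\<beta> ^ i = \<beta> ^ j\<close> by simp
  finally have ex: "0 < j - i \<and> \<beta> ^ (j - i) = 1"
    using nz \<open>i < j\<close> by simp
  define n where "n = (LEAST n. 0 < n \<and> \<beta> ^ n = 1)"
  have n: "0 < n" "\<beta> ^ n = 1" and least: "\<And>m. 0 < m \<Longrightarrow> \<beta> ^ m = 1 \<Longrightarrow> n \<le> m"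
    using LeastI[of "\<lambda>n. 0 < n \<and> \<beta> ^ n = 1", OF ex] Least_le[of "\<lambda>n. 0 < n \<and> \<beta> ^ n = 1"]
    unfolding n_def by auto
  have pow_mod: "\<beta> ^ k = \<beta> ^ (k mod n)" for k
  proof -
    have "\<beta> ^ k = (\<beta> ^ n) ^ (k div n) * \<beta> ^ (k mod n)"
      by (simp flip: power_mult power_add)
    then show ?thesis
      by (simp add: n)
  qed
  have ordered: "a = b" if "a \<le> b" "b < n" "\<beta> ^ a = \<beta> ^ b" for a b
  proof -
    have "\<beta> ^ a * \<beta> ^ (b - a) = \<beta> ^ (a + (b - a))"
      by (rule power_add[symmetric])
    also have "\<dots> = \<beta> ^ a * 1"
      using that by simp
    finally have "\<beta> ^ (b - a) = 1"
      using nz by simp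
    then show ?thesis
      using least[of "b - a"] that by (cases "a = b") auto
  qed
  then have inj: "inj_on (\<lambda>k. \<beta> ^ k) {..<n}"
    by (intro inj_onI) (metis lessThan_iff linear)
  have "UNIV - {0} = (\<lambda>k. \<beta> ^ k) ` {..<n}"
  proof (intro equalityI subsetI)
    fix x assume "x \<in> UNIV - {0 :: 'a}"
    then obtain k where "x = \<beta> ^ k"
      using gen by blast
    then show "x \<in> (\<lambda>k. \<beta> ^ k) ` {..<n}"
      using pow_mod[of k] n(1) by (intro image_eqI[of _ _ "k mod n"]) auto
  qed (use nz in auto)
  then have "card (UNIV - {0 :: 'a}) = n"
    using inj by (simp add: card_image)
  then have "n = CARD('a) - 1"
    by (simp add: card_Diff_subset)
  moreover have "\<beta> ^ k = \<beta> ^ l \<longleftrightarrow> k mod n = l mod n"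
  proof
    assume "\<beta> ^ k = \<beta> ^ l"
    then have "\<beta> ^ (k mod n) = \<beta> ^ (l mod n)"
      by (simp flip: pow_mod)
    then show "k mod n = l mod n"
      using inj n(1) by (simp add: inj_on_def)
  qed (metis pow_mod)
  ultimately show ?thesis
    by simp
qed

text \<open>The discrete logarithm modulo 4, naming the coset of fourth powers that contains
  \<open>x\<close>. For primitive \<beta> and 4 dividing the number of units it is independent of
  the chosen exponent; at 0 it is an unspecified number below 4, hence the guards
  \<open>x \<noteq> 0\<close>.\<close>

definition quartic_index :: "'a::{field,finite} \<Rightarrow> 'a \<Rightarrow> nat" where
  "quartic_index \<beta> x = (SOME k. x = \<beta> ^ k) mod 4"

text \<open>For the indicator of a connection set, the value at \<open>x - y\<close> is the entry at
  \<open>x\<close>, \<open>y\<close> of the squared adjacency matrix.\<close>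

definition convolution :: "('a::{ab_group_add,finite} \<Rightarrow> int) \<Rightarrow> 'a \<Rightarrow> int" where
  "convolution f d = (\<Sum>z\<in>UNIV. f z * f (d - z))"

lemma convolution_automorphism:
  assumes "bij \<phi>" and "\<And>x y. \<phi> (x - y) = \<phi> x - \<phi> y" and "\<And>x. g (\<phi> x) = f x"
  shows "convolution g (\<phi> d) = convolution f d"
proof -
  have "convolution g (\<phi> d) = (\<Sum>z\<in>UNIV. g (\<phi> z) * g (\<phi> d - \<phi> z))"
    unfolding convolution_def by (rule sum.reindex_bij_betw[OF assms(1), symmetric])
  then show ?thesis
    by (simp add: convolution_def assms flip: assms(2))
qed

lemma sum_minus_reindex:
  fixes f :: "'a::{ab_group_add,finite} \<Rightarrow> 'b::comm_monoid_add"
  shows "(\<Sum>z\<in>UNIV. f (d - z)) = (\<Sum>z\<in>UNIV. f z)"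
  by (rule sum.reindex_bij_witness[of _ "\<lambda>z. d - z" "\<lambda>z. d - z"]) auto

lemma sum_shift_reindex:
  fixes f :: "'a::{ab_group_add,finite} \<Rightarrow> 'b::comm_monoid_add"
  shows "(\<Sum>z\<in>UNIV. f (z - d)) = (\<Sum>z\<in>UNIV. f z)"
  by (rule sum.reindex_bij_witness[of _ "\<lambda>z. z + d" "\<lambda>z. z - d"]) auto

lemma sum_convolution:
  "(\<Sum>d\<in>UNIV. convolution f d) = (\<Sum>z\<in>UNIV. f z)\<^sup>2"
proof -
  have "(\<Sum>d\<in>UNIV. convolution f d) = (\<Sum>z\<in>UNIV. \<Sum>d\<in>UNIV. f z * f (d - z))"
    unfolding convolution_def by (rule sum.swap)
  then show ?thesis
    by (simp add: sum_shift_reindex power2_eq_square sum_distrib_right flip: sum_distrib_left)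
qed

section \<open>Cosets of the fourth powers\<close>

locale peisert =
  fixes p t r :: nat and \<beta> :: "'a::{field,finite}"
  assumes p: "prime p" "p mod 4 = 3" and t: "t \<ge> 1"
    and CARD_eq: "CARD('a) = p ^ (2 * t)"
    and primitive: "primitive_element \<beta>"
    and r: "CARD('a) = 4 * r + 1"
begin

lemma r_pos: "r > 0"
proof (rule ccontr)
  assume "\<not> r > 0"
  then have "p ^ (2 * t) = 1"
    using r CARD_eq by simp
  then show False
    using p(1) t by auto
qed

text \<open>\<open>q\<close> is an even power of an odd prime, hence 1 modulo 8; this is what makes
  \<open>- 1\<close> a fourth power.\<close>

lemma even_r: "even r"
proof -
  have "odd p"
    using p by presburger
  then have "(4 * r + 1) mod 8 = 1"
    using r CARD_eq odd_even_power_mod_8 by metis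
  then show ?thesis
    by presburger
qed

lemma \<beta>_nz [simp]: "\<beta> \<noteq> 0"
  using primitive by (simp add: primitive_element_def)

lemma primitiveE:
  assumes "x \<noteq> 0" obtains k where "x = \<beta> ^ k"
  using primitive assms by (auto simp: primitive_element_def)

text \<open>Exponents are determined modulo \<open>4 * r\<close>, the number of units. This makes
  \<open>ind\<close> well defined on units.\<close>

lemma power_eq_mod_4: "\<beta> ^ k = \<beta> ^ l \<Longrightarrow> k mod 4 = l mod 4"
proof -
  assume "\<beta> ^ k = \<beta> ^ l"
  then have "k mod (4 * r) = l mod (4 * r)"
    using primitive_power_eq_iff[OF primitive] r by simp
  then show ?thesis
    by (metis mod_mult_self2 mult_div_mod_eq mod_mod_cancel dvd_triv_left)
qed

abbreviation "ind \<equiv> quartic_index \<beta>"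

lemma ind_power [simp]: "ind (\<beta> ^ k) = k mod 4"
  unfolding quartic_index_def
  using someI[of "\<lambda>l. \<beta> ^ k = \<beta> ^ l" k] by (metis power_eq_mod_4)

lemma ind_less: "ind x < 4"
  by (simp add: quartic_index_def)

lemma ind_mult: "x \<noteq> 0 \<Longrightarrow> y \<noteq> 0 \<Longrightarrow> ind (x * y) = (ind x + ind y) mod 4"
  by (auto elim!: primitiveE simp: mod_add_eq simp flip: power_add)

lemma ind_pow: "x \<noteq> 0 \<Longrightarrow> ind (x ^ n) = (n * ind x) mod 4"
  by (auto elim!: primitiveE simp: mod_mult_right_eq mult.commute[of n] mod_mult_left_eq
      simp flip: power_mult)

lemma ind_\<beta> [simp]: "ind \<beta> = 1"
  using ind_power[of 1] by simp

text \<open>\<open>\<beta> ^ (2 * r)\<close> has square 1 without being 1, so it is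
  \<open>- 1\<close>, and its index is 0 because \<open>r\<close> is even.\<close>

lemma ind_minus: "ind (- x) = ind x"
proof (cases "x = 0")
  case False
  have "\<beta> ^ (2 * r) \<noteq> \<beta> ^ 0"
    using r_pos primitive_power_eq_iff[OF primitive, of "2 * r" 0] by (simp add: r)
  moreover have "(\<beta> ^ (2 * r))\<^sup>2 = \<beta> ^ 0"
    unfolding power_mult[symmetric] by (subst primitive_power_eq_iff[OF primitive]) (simp add: r)
  ultimately have "- 1 = \<beta> ^ (2 * r)"
    by (simp add: power2_eq_1_iff)
  moreover have "2 * r mod 4 = 0"
    using even_r by presburger
  ultimately have "ind (- 1) = 0"
    by (metis ind_power)
  then show ?thesis
    using ind_mult[of "- 1" x] False ind_less[of x] by simp
qed simp

lemma peisert_set_iff: "x \<in> peisert_set \<beta> \<longleftrightarrow> x \<noteq> 0 \<and> ind x < 2"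
proof -
  have C0: "x \<in> nonzero_fourth_powers \<longleftrightarrow> x \<noteq> 0 \<and> ind x = 0" for x
  proof
    assume "x \<noteq> 0 \<and> ind x = 0"
    then obtain k where k: "x = \<beta> ^ k" "k mod 4 = 0"
      by (metis ind_power primitiveE)
    then have "k div 4 * 4 = k"
      by presburger
    with k(1) have "x = (\<beta> ^ (k div 4)) ^ 4"
      by (metis power_mult)
    then show "x \<in> nonzero_fourth_powers"
      by (force simp: nonzero_fourth_powers_def)
  qed (auto simp: nonzero_fourth_powers_def ind_pow)
  have C1: "x \<in> (\<lambda>x. \<beta> * x) ` nonzero_fourth_powers \<longleftrightarrow> x \<noteq> 0 \<and> ind x = 1"
  proof
    assume x: "x \<noteq> 0 \<and> ind x = 1"
    have "ind (\<beta> * (x / \<beta>)) = (ind \<beta> + ind (x / \<beta>)) mod 4"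
      using x by (intro ind_mult) auto
    then have "ind x = (1 + ind (x / \<beta>)) mod 4"
      by simp
    with x have "1 = (1 + ind (x / \<beta>)) mod 4"
      by metis
    then have "ind (x / \<beta>) = 0"
      using ind_less[of "x / \<beta>"] by presburger
    then show "x \<in> (\<lambda>x. \<beta> * x) ` nonzero_fourth_powers"
      using x by (intro image_eqI[of _ _ "x / \<beta>"]) (auto simp: C0)
  qed (auto simp: C0 ind_mult)
  show ?thesis
    unfolding peisert_set_def by (auto simp: C0 C1)
qed

section \<open>Indicators of the connection set and of its complement in the units\<close>

definition s :: "'a \<Rightarrow> int" where
  "s x = (if x \<noteq> 0 \<and> ind x < 2 then 1 else 0)"

definition s' :: "'a \<Rightarrow> int" where
  "s' x = (if x \<noteq> 0 \<and> ind x \<ge> 2 then 1 else 0)"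

lemma bij_mult: "c \<noteq> 0 \<Longrightarrow> bij ((*) (c :: 'a))"
  by (rule bij_betw_byWitness[of _ "\<lambda>x. x / c"]) auto

text \<open>Multiplication by \<open>\<beta>\<^sup>2\<close> shifts the index by 2, swapping {0, 1}
  with {2, 3}: the graph is self-complementary.\<close>

lemma s_\<beta>2: "s (\<beta>\<^sup>2 * x) = s' x"
  using ind_less[of x] by (cases "x = 0") (auto simp: s_def s'_def ind_mult ind_pow, presburger+)

lemma s'_\<beta>2: "s' (\<beta>\<^sup>2 * x) = s x"
  using ind_less[of x] by (cases "x = 0") (auto simp: s_def s'_def ind_mult ind_pow, presburger+)

lemma s_s': "s x + s' x = (if x = 0 then 0 else 1)"
  by (simp add: s_def s'_def)

lemma sum_s: "(\<Sum>x\<in>UNIV. s x) = 2 * int r"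
proof -
  have "(\<Sum>x\<in>UNIV. s' x) = (\<Sum>x\<in>UNIV. s x)"
    using sum.reindex_bij_betw[OF bij_mult[of "\<beta>\<^sup>2"], of s] by (simp add: s_\<beta>2)
  moreover have "(\<Sum>x\<in>UNIV. s x) + (\<Sum>x\<in>UNIV. s' x) = (\<Sum>x::'a\<in>UNIV. 1 - (if x = 0 then 1 else 0))"
    unfolding sum.distrib[symmetric] by (intro sum.cong) (auto simp: s_s')
  then have "(\<Sum>x\<in>UNIV. s x) + (\<Sum>x\<in>UNIV. s' x) = 4 * int r"
    by (simp add: sum_subtractf r)
  ultimately show ?thesis
    by simp
qed

lemma sum_s': "(\<Sum>x\<in>UNIV. s' x) = 2 * int r"
  using sum.reindex_bij_betw[OF bij_mult[of "\<beta>\<^sup>2"], of s] by (simp add: s_\<beta>2 sum_s)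

text \<open>Frobenius followed by multiplication by \<beta>: an additive automorphism that preserves
  the connection set while linking cosets which multiplication by fourth powers keeps apart.\<close>

definition \<phi> :: "'a \<Rightarrow> 'a" where
  "\<phi> x = \<beta> * x ^ p"

lemma \<phi>_add: "\<phi> (x + y) = \<phi> x + \<phi> y"
proof -
  have "CHAR('a) = p"
    using p(1) CARD_eq by (rule CHAR_eq_of_CARD_prime_power)
  then have "(x + y) ^ p = x ^ p + y ^ p"
    using p(1) by (intro freshmans_dream) simp_all
  then show ?thesis
    by (simp add: \<phi>_def distrib_left)
qed

lemma \<phi>_diff: "\<phi> (x - y) = \<phi> x - \<phi> y"
  using \<phi>_add[of "x - y" y] by simp

lemma \<phi>_eq_0_iff: "\<phi> x = 0 \<longleftrightarrow> x = 0"
  using p(1) by (auto simp: \<phi>_def prime_gt_0_nat)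

lemma bij_\<phi>: "bij \<phi>"
proof -
  have "inj \<phi>"
    by (rule injI) (metis \<phi>_diff \<phi>_eq_0_iff right_minus_eq)
  then show ?thesis
    by (simp add: bij_def finite_UNIV_inj_surj)
qed

text \<open>Since \<open>p \<equiv> 3 (mod 4)\<close>, the map \<open>\<phi>\<close> exchanges \<open>C\<^sub>0\<close> with \<open>C\<^sub>1\<close> and \<open>C\<^sub>2\<close> with \<open>C\<^sub>3\<close>.\<close>

lemma ind_\<phi>: "x \<noteq> 0 \<Longrightarrow> ind (\<phi> x) = (1 + 3 * ind x) mod 4"
proof -
  assume "x \<noteq> 0"
  then have "ind (\<phi> x) = (1 + p * ind x) mod 4"
    by (simp add: \<phi>_def ind_mult ind_pow mod_simps)
  also have "\<dots> = (1 + p mod 4 * ind x) mod 4"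
    by (metis mod_add_right_eq mod_mult_left_eq)
  finally have "ind (\<phi> x) = (1 + p mod 4 * ind x) mod 4" .
  then show ?thesis
    by (simp add: p(2))
qed

lemma s_\<phi>: "s (\<phi> x) = s x"
proof (cases "x = 0")
  case False
  have "(1 + 3 * k) mod 4 < 2 \<longleftrightarrow> k < 2" if "k < 4" for k :: nat
    using that by presburger
  then show ?thesis
    using False ind_less[of x] by (simp add: s_def ind_\<phi> \<phi>_eq_0_iff)
qed (simp add: s_def \<phi>_eq_0_iff)

section \<open>Common neighbour counts\<close>

lemma conv_\<phi>: "convolution s (\<phi> d) = convolution s d"
  by (rule convolution_automorphism) (auto simp: bij_\<phi> \<phi>_diff s_\<phi>)

text \<open>The quotient \<open>e / d\<close> has index 0, so multiplication by it is an additive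
  automorphism preserving \<open>s\<close>.\<close>

lemma conv_ind:
  assumes "d \<noteq> 0" "e \<noteq> 0" "ind d = ind e"
  shows "convolution s d = convolution s e"
proof -
  define c where "c = e / d"
  have c: "c \<noteq> 0" "e = c * d"
    using assms by (auto simp: c_def)
  then have "ind e = (ind c + ind d) mod 4"
    using assms by (simp add: ind_mult)
  then have "ind c = 0"
    using assms(3) ind_less[of c] ind_less[of d] by presburger
  then have "s (c * x) = s x" for x
    using c(1) ind_less[of x] by (cases "x = 0") (auto simp: s_def ind_mult)
  then have "convolution s (c * d) = convolution s d"
    by (intro convolution_automorphism bij_mult c) (auto simp: right_diff_distrib)
  then show ?thesis
    by (simp add: c(2))
qed

text \<open>If the indices differ, \<open>\<phi>\<close> carries the coset of \<open>d\<close> to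
  that of \<open>e\<close>. So the convolution takes at most two values off 0.\<close>

lemma conv_eq:
  assumes "d \<noteq> 0" "e \<noteq> 0" "ind d < 2 \<longleftrightarrow> ind e < 2"
  shows "convolution s d = convolution s e"
proof (cases "ind d = ind e")
  case False
  have "ind (\<phi> d) = ind e"
  proof -
    have "(1 + 3 * k) mod 4 = l" if "k < 4" "l < 4" "k < 2 \<longleftrightarrow> l < 2" "k \<noteq> l" for k l :: nat
    proof -
      have "k \<in> {0, 1, 2, 3}" "l \<in> {0, 1, 2, 3}"
        using that by auto
      then show ?thesis
        using that by auto
    qed
    then show ?thesis
      using assms False ind_less[of d] ind_less[of e] by (simp add: ind_\<phi>)
  qed
  then have "convolution s (\<phi> d) = convolution s e"
    using assms by (intro conv_ind) (auto simp: \<phi>_eq_0_iff)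
  then show ?thesis
    by (simp add: conv_\<phi>)
qed (use assms in \<open>auto intro: conv_ind\<close>)

lemma conv_s': "convolution s' (\<beta>\<^sup>2 * d) = convolution s d"
  by (rule convolution_automorphism) (auto simp: bij_mult right_diff_distrib s'_\<beta>2)

lemma conv_complement:
  assumes "d \<noteq> 0"
  shows "convolution s d + s d = convolution s' d + s' d"
proof -
  define \<delta> :: "'a \<Rightarrow> int" where "\<delta> x = (if x = 0 then 1 else 0)" for x
  have s: "s x = 1 - s' x - \<delta> x" for x
    using s_s'[of x] by (auto simp: \<delta>_def)
  \<comment> \<open>The product of the two factors \<open>\<delta> z\<close> and
    \<open>\<delta> (d - z)\<close> vanishes because \<open>d \<noteq> 0\<close>.\<close>
  have "s z * s (d - z) = s' z * s' (d - z) + 1 - s' z - s' (d - z)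
      - \<delta> z * (1 - s' (d - z)) - \<delta> (d - z) * (1 - s' z)" for z
    using assms by (auto simp: s algebra_simps \<delta>_def)
  then have "convolution s d = convolution s' d + (4 * int r + 1) - (\<Sum>z\<in>UNIV. s' z)
      - (\<Sum>z\<in>UNIV. s' (d - z)) - (\<Sum>z\<in>UNIV. \<delta> z * (1 - s' (d - z)))
      - (\<Sum>z\<in>UNIV. \<delta> (d - z) * (1 - s' z))"
    by (simp add: convolution_def sum_subtractf sum.distrib r)
  also have "(\<Sum>z\<in>UNIV. \<delta> z * (1 - s' (d - z))) = 1 - s' d"
    by (simp add: \<delta>_def if_distrib[of "\<lambda>x. x * _"] cong: if_cong)
  also have "(\<Sum>z\<in>UNIV. \<delta> (d - z) * (1 - s' z)) = 1 - s' d"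
    by (simp add: \<delta>_def if_distrib[of "\<lambda>x. x * _"] cong: if_cong)
  finally have "convolution s d = convolution s' d + 2 * s' d - 1"
    by (simp add: sum_minus_reindex sum_s')
  then show ?thesis
    using s_s'[of d] assms by simp
qed

text \<open>Off 0 the value is \<open>a\<close> on the connection set and \<open>b\<close> on its
  complement. Self-complementarity gives \<open>b = a + 1\<close>, and summing over all
  \<open>d\<close> gives \<open>1 + a + b = 2 * r\<close>; hence \<open>a = r - 1\<close> and
  \<open>b = r\<close>, the parameters of a conference graph.\<close>

lemma conv_s: "convolution s d = (if d = 0 then 2 * int r else int r - s d)"
proof -
  define a b where "a = convolution s 1" and "b = convolution s (\<beta>\<^sup>2)"
  have ind1: "ind 1 = 0"
    using ind_power[of 0] by simp
  have conv: "convolution s d = (if ind d < 2 then a else b)" if "d \<noteq> 0" for d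
    using that conv_eq[of d 1] conv_eq[of d "\<beta>\<^sup>2"] by (auto simp: a_def b_def ind1)
  have "convolution s 0 = (\<Sum>z\<in>UNIV. s z)"
    by (auto simp: convolution_def s_def ind_minus intro!: sum.cong)
  then have conv0: "convolution s 0 = 2 * int r"
    by (simp add: sum_s)
  have "convolution s' (\<beta>\<^sup>2) + s' (\<beta>\<^sup>2) = convolution s (\<beta>\<^sup>2) + s (\<beta>\<^sup>2)"
    using conv_complement[of "\<beta>\<^sup>2"] by simp
  then have b: "b = a + 1"
    using conv_s'[of 1] by (simp add: a_def b_def s_def s'_def)
  have "(2 * int r)\<^sup>2 = (\<Sum>d\<in>UNIV. convolution s d)"
    by (simp add: sum_convolution sum_s)
  also have "\<dots> = (\<Sum>d\<in>UNIV. (if d = 0 then 2 * int r else 0) + a * s d + b * s' d)"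
    by (intro sum.cong) (auto simp: conv conv0 s_def s'_def)
  also have "\<dots> = 2 * int r + a * (2 * int r) + b * (2 * int r)"
    by (simp add: sum.distrib sum_s sum_s' flip: sum_distrib_left)
  finally have "2 * int r * (2 * int r) = 2 * int r * (1 + a + b)"
    by (simp add: power2_eq_square algebra_simps)
  then have "2 * int r = 1 + a + b"
    using r_pos by simp
  then show ?thesis
    using b conv[of d] conv0 by (auto simp: s_def)
qed

end

section \<open>The cokernel of the adjacency matrix\<close>

lemma range_smult:
  fixes A :: "int ^ 'n::finite ^ 'm::finite"
  shows "v \<in> range ((*v) A) \<Longrightarrow> c *s v \<in> range ((*v) A)"
  by (auto simp flip: matrix_vector_mult_smult)

lemma range_add:
  fixes A :: "int ^ 'n::finite ^ 'm::finite"
  shows "v \<in> range ((*v) A) \<Longrightarrow> w \<in> range ((*v) A) \<Longrightarrow> v + w \<in> range ((*v) A)"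
  by (auto simp flip: matrix_vector_right_distrib)

lemma range_zero:
  fixes A :: "int ^ 'n::finite ^ 'm::finite"
  shows "0 \<in> range ((*v) A)"
  by (rule range_eqI[of _ _ 0]) simp

lemma range_sum:
  fixes A :: "int ^ 'n::finite ^ 'm::finite"
  shows "(\<And>j. j \<in> J \<Longrightarrow> f j \<in> range ((*v) A)) \<Longrightarrow> sum f J \<in> range ((*v) A)"
  by (induction J rule: infinite_finite_induct) (auto simp: range_zero range_add)

lemma coset_eq_iff:
  fixes A :: "int ^ 'n::finite ^ 'm::finite"
  shows "range ((*v) A) #>\<^bsub>int_vec_group\<^esub> v = range ((*v) A) #>\<^bsub>int_vec_group\<^esub> w
    \<longleftrightarrow> v - w \<in> range ((*v) A)" (is "?L v = ?L w \<longleftrightarrow> _")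
proof -
  have L: "x \<in> ?L v \<longleftrightarrow> x - v \<in> range ((*v) A)" for x v
    by (force simp: r_coset_def int_vec_group_def algebra_simps)
  show ?thesis
  proof
    have "v \<in> ?L v"
      unfolding L by (simp add: range_zero)
    moreover assume "?L v = ?L w"
    ultimately show "v - w \<in> range ((*v) A)"
      by (simp add: L)
  next
    assume *: "v - w \<in> range ((*v) A)"
    show "?L v = ?L w"
    proof (rule Set.set_eqI)
      fix x
      have "x - v = (x - w) + (- 1) *s (v - w)" "x - w = (x - v) + (v - w)"
        by (simp_all add: vec_eq_iff)
      with * show "x \<in> ?L v \<longleftrightarrow> x \<in> ?L w"
        unfolding L by (metis range_add range_smult)
    qed
  qed
qed

text \<open>The coordinate sum maps the cokernel onto the integers modulo \<open>k\<close>, and the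
  class of \<open>e\<close>, killed by \<open>k\<close>, splits this map. Its kernel is
  \<open>sum_zero\<close> modulo \<open>A sum_zero\<close>, where the \<open>g i\<close> form a
  basis modulo \<open>r\<close>.\<close>

lemma cokernel_iso_product:
  fixes A :: "int ^ 'n::finite ^ 'n" and e :: "int ^ 'n" and g :: "nat \<Rightarrow> int ^ 'n"
  assumes "k > 0" "r > 0"
    and sum_A: "\<And>v. (\<Sum>x\<in>UNIV. (A *v v) $ x) = int k * (\<Sum>x\<in>UNIV. v $ x)"
    and sum_e: "(\<Sum>x\<in>UNIV. e $ x) = 1" and ke: "int k *s e \<in> range ((*v) A)"
    and g: "\<And>i. g i \<in> sum_zero" "\<And>i. int r *s g i \<in> range ((*v) A)"
    and span: "\<And>y. y \<in> sum_zero \<Longrightarrow> \<exists>a. \<exists>u\<in>sum_zero. y = (\<Sum>i<N. a i *s g i) + A *v u"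
    and indep: "\<And>a u i. u \<in> sum_zero \<Longrightarrow> (\<Sum>i<N. a i *s g i) = A *v u \<Longrightarrow> i < N \<Longrightarrow> int r dvd a i"
  shows "cokernel A \<cong> integer_mod_group k \<times>\<times> product_group {..<N} (\<lambda>_. integer_mod_group r)"
    (is "_ \<cong> ?P")
proof -
  let ?L = "range ((*v) A)"
  interpret L: normal ?L int_vec_group
    using normal_range_matrix[of A] by simp
  have carrier: "carrier ?P = {0..<int k} \<times> ({..<N} \<rightarrow>\<^sub>E {0..<int r})"
    using \<open>k > 0\<close> \<open>r > 0\<close> by (simp add: carrier_integer_mod_group)
  define v where "v c a = c *s e + (\<Sum>i<N. a i *s g i)" for c and a :: "nat \<Rightarrow> int"
  define h where "h = (\<lambda>(c, a). ?L #>\<^bsub>int_vec_group\<^esub> v c a)"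
  have mod_diff: "x mod y - x = - (x div y) * y" for x y :: int
    using div_mult_mod_eq[of x y] by linarith
  \<comment> \<open>Reducing coefficients changes the vector by multiples of \<open>k *s e\<close>
    and \<open>r *s g i\<close>, which lie in the image.\<close>
  have v_mod: "v (c mod int k) (\<lambda>i\<in>{..<N}. a i mod int r) - v c a \<in> ?L" for c a
  proof -
    have "(\<Sum>i<N. (\<lambda>i\<in>{..<N}. a i mod int r) i *s g i) - (\<Sum>i<N. a i *s g i)
        = (\<Sum>i<N. (- (a i div int r)) *s (int r *s g i))"
      unfolding sum_smult_diff[symmetric] vector_smult_assoc
      by (rule sum.cong) (simp_all add: mod_diff)
    moreover have "(c mod int k) *s e - c *s e = (- (c div int k)) *s (int k *s e)"
      unfolding vector_sub_rdistrib[symmetric] vector_smult_assoc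
      by (simp only: mod_diff)
    ultimately have "v (c mod int k) (\<lambda>i\<in>{..<N}. a i mod int r) - v c a
        = (- (c div int k)) *s (int k *s e) + (\<Sum>i<N. (- (a i div int r)) *s (int r *s g i))"
      unfolding v_def add_diff_add by (simp only:)
    also have "\<dots> \<in> ?L"
      by (intro range_add range_sum range_smult ke g(2))
    finally show ?thesis .
  qed
  have "h \<in> hom ?P (cokernel A)"
  proof (rule homI)
    fix x assume "x \<in> carrier ?P"
    show "h x \<in> carrier (cokernel A)"
      by (auto simp: h_def cokernel_def FactGroup_def RCOSETS_def int_vec_group_def split: prod.split)
  next
    fix x y assume "x \<in> carrier ?P" "y \<in> carrier ?P"
    obtain c a d b where xy: "x = (c, a)" "y = (d, b)"
      by fastforce
    have "h (x \<otimes>\<^bsub>?P\<^esub> y) = ?L #>\<^bsub>int_vec_group\<^esub> v ((c + d) mod int k) (\<lambda>i\<in>{..<N}. (a i + b i) mod int r)"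
      by (simp add: xy h_def)
    also have "\<dots> = ?L #>\<^bsub>int_vec_group\<^esub> v (c + d) (\<lambda>i. a i + b i)"
      unfolding coset_eq_iff by (rule v_mod)
    also have "v (c + d) (\<lambda>i. a i + b i) = v c a \<otimes>\<^bsub>int_vec_group\<^esub> v d b"
      by (simp add: v_def int_vec_group_def sum.distrib vector_sadd_rdistrib)
    also have "?L #>\<^bsub>int_vec_group\<^esub> \<dots> = h x <#>\<^bsub>int_vec_group\<^esub> h y"
      unfolding xy h_def prod.case by (rule L.rcos_sum[symmetric]) (simp_all add: int_vec_group_def)
    finally show "h (x \<otimes>\<^bsub>?P\<^esub> y) = h x \<otimes>\<^bsub>cokernel A\<^esub> h y"
      by (simp add: cokernel_def FactGroup_def)
  qed
  moreover have "inj_on h (carrier ?P)"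
  proof (rule inj_onI)
    fix x y assume x: "x \<in> carrier ?P" and y: "y \<in> carrier ?P" and eq: "h x = h y"
    obtain c a d b where xy: "x = (c, a)" "y = (d, b)"
      by fastforce
    have c: "c \<in> {0..<int k}" "d \<in> {0..<int k}"
      and a: "a \<in> {..<N} \<rightarrow>\<^sub>E {0..<int r}" "b \<in> {..<N} \<rightarrow>\<^sub>E {0..<int r}"
      using x y unfolding carrier xy by auto
    from eq have "v c a - v d b \<in> ?L"
      by (simp add: h_def xy coset_eq_iff)
    then obtain u where u: "v c a - v d b = A *v u"
      by blast
    have vab: "v c a - v d b = (c - d) *s e + (\<Sum>i<N. (a i - b i) *s g i)"
      by (simp add: v_def vector_sub_rdistrib sum_subtractf)
    have "(\<Sum>i<N. (a i - b i) *s g i) \<in> sum_zero"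
      using g(1) by simp
    then have "(\<Sum>x\<in>UNIV. (\<Sum>i<N. (a i - b i) *s g i) $ x) = 0"
      unfolding sum_zero_def by blast
    then have "(\<Sum>x\<in>UNIV. (A *v u) $ x) = c - d"
      unfolding u[symmetric] vab using sum_e by (simp add: sum.distrib flip: sum_distrib_left)
    then have cd: "c - d = int k * (\<Sum>x\<in>UNIV. u $ x)"
      by (simp add: sum_A)
    then have "c mod int k = d mod int k"
      by (simp add: mod_eq_dvd_iff)
    then have "c = d"
      using c by simp
    \<comment> \<open>Once \<open>c = d\<close>, the preimage \<open>u\<close> itself has sum 0, as
      \<open>indep\<close> demands.\<close>
    then have "(\<Sum>x\<in>UNIV. u $ x) = 0"
      using cd \<open>k > 0\<close> by simp
    then have "u \<in> sum_zero"
      by (simp add: sum_zero_def)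
    moreover have "(\<Sum>i<N. (a i - b i) *s g i) = A *v u"
      using u vab \<open>c = d\<close> by simp
    ultimately have dvd: "int r dvd a i - b i" if "i < N" for i
      using that by (rule indep)
    have "a = b"
    proof (rule PiE_ext[OF a])
      fix i assume "i \<in> {..<N}"
      then have "a i mod int r = b i mod int r" "a i \<in> {0..<int r}" "b i \<in> {0..<int r}"
        using dvd a by (auto simp: mod_eq_dvd_iff)
      then show "a i = b i"
        by simp
    qed
    with \<open>c = d\<close> show "x = y"
      by (simp add: xy)
  qed
  moreover have "h ` carrier ?P = carrier (cokernel A)"
  proof (intro equalityI subsetI)
    fix X assume "X \<in> carrier (cokernel A)"
    then obtain w where w: "X = ?L #>\<^bsub>int_vec_group\<^esub> w"
      by (auto simp: cokernel_def FactGroup_def RCOSETS_def)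
    define c where "c = (\<Sum>x\<in>UNIV. w $ x)"
    have "w - c *s e \<in> sum_zero"
      using sum_e by (simp add: sum_zero_def sum_subtractf c_def flip: sum_distrib_left)
    then obtain a u where "w - c *s e = (\<Sum>i<N. a i *s g i) + A *v u"
      using span by blast
    then have "w - v c a = A *v u"
      by (simp add: v_def algebra_simps)
    then have "X = ?L #>\<^bsub>int_vec_group\<^esub> v c a"
      unfolding w coset_eq_iff by blast
    also have "\<dots> = ?L #>\<^bsub>int_vec_group\<^esub> v (c mod int k) (\<lambda>i\<in>{..<N}. a i mod int r)"
      using v_mod[of c a] by (metis coset_eq_iff)
    also have "\<dots> = h (c mod int k, \<lambda>i\<in>{..<N}. a i mod int r)"
      by (simp add: h_def)
    finally show "X \<in> h ` carrier ?P"
      unfolding carrier using \<open>k > 0\<close> \<open>r > 0\<close> by auto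
  qed (auto simp: h_def cokernel_def FactGroup_def RCOSETS_def int_vec_group_def)
  ultimately have "h \<in> iso ?P (cokernel A)"
    by (simp add: iso_def bij_betw_def)
  then have "?P \<cong> cokernel A"
    by (rule is_isoI)
  moreover have "group ?P"
    by (intro DirProd_group product_group group_integer_mod_group)
  ultimately show ?thesis
    by (rule group.iso_sym[rotated])
qed

section \<open>The Smith group of the Peisert graph\<close>

context peisert
begin

abbreviation "adj \<equiv> adjacency_matrix (peisert_adj \<beta>)"

lemma adj_nth: "adj $ x $ y = s (x - y)"
  by (auto simp: adjacency_matrix_def peisert_adj_def peisert_set_iff s_def)

lemma adj_mult_nth: "(adj *v v) $ x = (\<Sum>y\<in>UNIV. s (x - y) * v $ y)"
  by (simp add: matrix_vector_mult_def adj_nth)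

lemma sum_adj_mult: "(\<Sum>x\<in>UNIV. (adj *v v) $ x) = 2 * int r * (\<Sum>x\<in>UNIV. v $ x)"
proof -
  have "(\<Sum>x\<in>UNIV. (adj *v v) $ x) = (\<Sum>y\<in>UNIV. \<Sum>x\<in>UNIV. s (x - y) * v $ y)"
    unfolding adj_mult_nth by (rule sum.swap)
  then show ?thesis
    by (simp add: sum_shift_reindex sum_s flip: sum_distrib_left sum_distrib_right)
qed

lemma adj_square:
  "(adj *v (adj *v v)) $ x = int r * v $ x - (adj *v v) $ x + int r * (\<Sum>y\<in>UNIV. v $ y)"
proof -
  have "(adj *v (adj *v v)) $ x = (\<Sum>y\<in>UNIV. \<Sum>w\<in>UNIV. s (x - y) * (s (y - w) * v $ w))"
    unfolding adj_mult_nth by (simp add: sum_distrib_left)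
  also have "\<dots> = (\<Sum>w\<in>UNIV. \<Sum>y\<in>UNIV. s (x - y) * (s (y - w) * v $ w))"
    by (rule sum.swap)
  also have "\<dots> = (\<Sum>w\<in>UNIV. convolution s (x - w) * v $ w)"
  proof (rule sum.cong)
    fix w :: 'a
    \<comment> \<open>The substitution \<open>y = x - z\<close> turns the count of walks of length 2
      into a convolution.\<close>
    have "(\<Sum>y\<in>UNIV. s (x - y) * (s (y - w) * v $ w))
        = (\<Sum>z\<in>UNIV. s (x - (x - z)) * (s ((x - z) - w) * v $ w))"
      by (rule sum_minus_reindex[symmetric])
    then show "(\<Sum>y\<in>UNIV. s (x - y) * (s (y - w) * v $ w)) = convolution s (x - w) * v $ w"
      by (simp add: convolution_def sum_distrib_right mult.assoc diff_diff_eq add.commute)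
  qed simp
  \<comment> \<open>At \<open>w = x\<close> the value \<open>2 * r\<close> is
    \<open>r + (r - s 0)\<close> with \<open>s 0 = 0\<close>; this separates \<open>r I\<close> from
    \<open>r J - A\<close>.\<close>
  also have "\<dots> = (\<Sum>w\<in>UNIV. (if w = x then int r * v $ x else 0) + (int r - s (x - w)) * v $ w)"
    by (intro sum.cong) (auto simp: conv_s s_def algebra_simps)
  finally show ?thesis
    by (simp add: adj_mult_nth sum.distrib left_diff_distrib sum_subtractf flip: sum_distrib_left)
qed

text \<open>The permutation matrix of an isomorphism between the graph and its complement.\<close>

definition Q :: "((int, 'a) vec, 'a) vec" where
  "Q = (\<chi> x y. if y = \<beta>\<^sup>2 * x then 1 else 0)"

lemma Q_mult_nth: "(Q *v v) $ x = v $ (\<beta>\<^sup>2 * x)"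
  by (simp add: matrix_vector_mult_def Q_def if_distrib[of "\<lambda>x. x * _"] cong: if_cong)

lemma sum_Q_mult: "(\<Sum>x\<in>UNIV. (Q *v v) $ x) = (\<Sum>x\<in>UNIV. v $ x)"
  unfolding Q_mult_nth by (rule sum.reindex_bij_betw[OF bij_mult]) simp

text \<open>Conjugation by \<open>Q\<close> turns \<open>A\<close> into the matrix
  \<open>J - I - A\<close> of the complement, and \<open>J\<close> vanishes on
  \<open>sum_zero\<close>.\<close>

lemma Q_adj:
  assumes "v \<in> sum_zero"
  shows "Q *v (adj *v v) = - (Q *v v) - adj *v (Q *v v)"
proof (subst vec_eq_iff, intro allI)
  fix x
  have "(Q *v (adj *v v)) $ x = (\<Sum>y\<in>UNIV. s (\<beta>\<^sup>2 * x - \<beta>\<^sup>2 * y) * v $ (\<beta>\<^sup>2 * y))"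
    unfolding Q_mult_nth adj_mult_nth
    by (rule sum.reindex_bij_betw[OF bij_mult, symmetric]) simp
  also have "\<dots> = (\<Sum>y\<in>UNIV. s' (x - y) * v $ (\<beta>\<^sup>2 * y))"
    by (simp add: s_\<beta>2 flip: right_diff_distrib)
  also have "\<dots> = (\<Sum>y\<in>UNIV. (Q *v v) $ y - (if y = x then (Q *v v) $ x else 0)
      - s (x - y) * (Q *v v) $ y)"
  proof (intro sum.cong refl)
    fix y
    show "s' (x - y) * v $ (\<beta>\<^sup>2 * y) = (Q *v v) $ y - (if y = x then (Q *v v) $ x else 0)
      - s (x - y) * (Q *v v) $ y"
      by (auto simp: Q_mult_nth s_def s'_def)
  qed
  also have "\<dots> = (- (Q *v v) - adj *v (Q *v v)) $ x"
    using assms by (simp add: sum_subtractf sum_Q_mult adj_mult_nth sum_zero_def)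
  finally show "(Q *v (adj *v v)) $ x = (- (Q *v v) - adj *v (Q *v v)) $ x" .
qed

lemma Q_bij: "bij_betw ((*v) Q) sum_zero sum_zero"
proof (rule bij_betw_byWitness[of _ "\<lambda>v. \<chi> x. v $ (x / \<beta>\<^sup>2)"])
  show "(\<lambda>v. \<chi> x. v $ (x / \<beta>\<^sup>2)) ` sum_zero \<subseteq> sum_zero"
  proof
    fix w assume "w \<in> (\<lambda>v. \<chi> x. v $ (x / \<beta>\<^sup>2)) ` (sum_zero :: ((int, 'a) vec) set)"
    then obtain v where "v \<in> sum_zero" "w = (\<chi> x. v $ (x / \<beta>\<^sup>2))"
      by blast
    moreover from this have "Q *v w = v"
      by (simp add: vec_eq_iff Q_mult_nth)
    ultimately show "w \<in> sum_zero"
      using sum_Q_mult[of w] by (simp add: sum_zero_def)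
  qed
  show "(*v) Q ` sum_zero \<subseteq> sum_zero"
    by (auto simp: sum_zero_def sum_Q_mult)
qed (auto simp: vec_eq_iff Q_mult_nth)

sublocale split_lattice adj Q r "2 * r"
proof
  show "adj *v y \<in> sum_zero" if "y \<in> sum_zero" for y
    using that by (simp add: sum_zero_def sum_adj_mult)
  show "adj *v (adj *v y) = int r *s y - adj *v y" if "y \<in> sum_zero" for y
    using that by (subst vec_eq_iff) (simp add: adj_square sum_zero_def)
qed (use r r_pos Q_bij Q_adj in auto)

lemma smith_group_iso:
  "smith_group (peisert_adj \<beta>) \<cong>
    integer_mod_group (2 * r) \<times>\<times> product_group {..<2 * r} (\<lambda>_. integer_mod_group r)"
proof (rule exists_basis_mod_image)
  fix g :: "nat \<Rightarrow> (int, 'a) vec"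
  assume g: "\<And>i. g i \<in> sum_zero"
    and span: "\<And>y. y \<in> sum_zero \<Longrightarrow> \<exists>a. \<exists>u\<in>sum_zero. y = (\<Sum>i<2 * r. a i *s g i) + adj *v u"
    and indep: "\<And>a u i. u \<in> sum_zero \<Longrightarrow> (\<Sum>i<2 * r. a i *s g i) = adj *v u \<Longrightarrow> i < 2 * r
      \<Longrightarrow> int r dvd a i"
  define e :: "(int, 'a) vec" where "e = axis 0 1"
  have sum_e: "(\<Sum>x\<in>UNIV. e $ x) = 1"
    by (simp add: e_def axis_def)
  have adj_1: "(adj *v 1) $ x = 2 * int r" for x
    by (simp add: adj_mult_nth sum_minus_reindex sum_s)
  \<comment> \<open>Here \<open>1\<close> is the all-ones vector. In \<open>2 A (A + 1) e\<close>
    the terms in \<open>A e\<close> cancel and leave \<open>2 r e + 2 r 1\<close>; subtracting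
    \<open>A 1 = 2 r 1\<close> removes the constant part.\<close>
  have "adj *v (2 *s (adj *v e) + 2 *s e - 1) = int (2 * r) *s e"
    by (subst vec_eq_iff) (simp add: matrix_linear adj_square adj_1 sum_e algebra_simps)
  then have e: "int (2 * r) *s e \<in> range ((*v) adj)"
    by (metis rangeI)
  have "int r *s g i = adj *v (adj *v g i + g i)" for i
    using g A_quadratic[of "g i"] by (simp add: matrix_linear)
  then have rg: "int r *s g i \<in> range ((*v) adj)" for i
    by (metis rangeI)
  show ?thesis
    unfolding smith_group_def
  proof (rule cokernel_iso_product[where e = e and g = g])
    show "int r dvd a i" if "u \<in> sum_zero" "(\<Sum>i<2 * r. a i *s g i) = adj *v u" "i < 2 * r" for a u i
      using that by (rule indep)
  qed (use r_pos sum_adj_mult sum_e e g rg span in auto)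
qed

end

theorem theorem3p1:
  fixes p t q r :: nat
    and \<beta> :: "'a::{field,finite}"
  assumes "prime p"
    and "p mod 4 = 3"
    and "t \<ge> 1"
    and "q = p ^ (2 * t)"
    and "r = (q - 1) div 4"
    and "CARD('a) = q"
    and "primitive_element \<beta>"
  shows "smith_group (peisert_adj \<beta>) \<cong>
    integer_mod_group (2 * r) \<times>\<times> product_group {..<2 * r} (\<lambda>_. integer_mod_group r)"
proof -
  have "odd p"
    using assms(2) by presburger
  then have "q mod 8 = 1"
    unfolding assms(4) by (rule odd_even_power_mod_8)
  \<comment> \<open>Being 1 modulo 8 makes the division by 4 in the definition of \<open>r\<close>
    exact.\<close>
  then have "q - 1 = 4 * (2 * (q div 8))" and "q > 0"
    using mult_div_mod_eq[of 8 q] by simp_all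
  then have "q = 4 * r + 1"
    using assms(5) by simp
  then interpret peisert p t r \<beta>
    by unfold_locales (use assms in auto)
  show ?thesis
    by (rule smith_group_iso)
qed

end
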